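(* Let $\alpha_1, A_1, \alpha_2 > 0$ and consider the system of difference equations $$x_{n+1}=\frac{\alpha_{1}}{A_{1}+y_{n}},\qquad y_{n+1}=\frac{\alpha_{2}}{x_{n}},\qquad n=0,1,2,\dots,$$ with arbitrary nonnegative initial conditions $x_0,y_0$ such that the denominators are never zero. (1) If $\alpha_{1}>\alpha_{2}$, then there is a unique equilibrium, namely $$(\bar{x},\bar{y})=\left(\frac{\alpha_{1}(\alpha_{1}-\alpha_{2})}{A_{1}(\alpha_{1}-\alpha_{2})+\alpha_{2}A_{1}},\frac{\alpha_{2}A_{1}}{\alpha_{1}-\alpha_{2}}\right),$$ and it is globally asymptotically stable. (2) If $\alpha_{1}\leq \alpha_{2}$, then there are no nonnegative equilibria and $\lim_{n\rightarrow \infty}(x_{n},y_{n})=(0,\infty)$ for all choices of initial conditions.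
   Context: The state space consists of nonnegative points. An initial condition $(x_0,y_0)\in[0,\infty)^2$ is admissible if no denominator ever vanishes along its orbit (here this means $x_0>0$, $y_0\ge 0$). An equilibrium is an admissible point $(\bar x,\bar y)\in[0,\infty)^2$ such that the constant sequence $(x_n,y_n)=(\bar x,\bar y)$ solves the system. An equilibrium is globally asymptotically stable if it is Lyapunov stable (for every $\varepsilon>0$ there is $\delta>0$ such that every admissible initial condition within $\delta$ of $(\bar x,\bar y)$ has its whole orbit within $\varepsilon$ of $(\bar x,\bar y)$) and every solution with admissible initial condition converges to $(\bar x,\bar y)$. The notation $\lim_{n\to\infty}(x_n,y_n)=(0,\infty)$ means $x_n\to 0$ and $y_n\to\infty$. *)

theory Defs
  imports "HOL-Analysis.Analysis"
begin

definition step :: "real \<Rightarrow> real \<Rightarrow> real \<Rightarrow> real \<times> real \<Rightarrow> real \<times> real" where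
  "step \<alpha>1 A1 \<alpha>2 z = (\<alpha>1 / (A1 + snd z), \<alpha>2 / fst z)"

definition denominators_nonzero :: "real \<Rightarrow> real \<times> real \<Rightarrow> bool" where
  "denominators_nonzero A1 z \<longleftrightarrow> A1 + snd z \<noteq> 0 \<and> fst z \<noteq> 0"

definition is_solution :: "real \<Rightarrow> real \<Rightarrow> real \<Rightarrow> (nat \<Rightarrow> real \<times> real) \<Rightarrow> bool" where
  "is_solution \<alpha>1 A1 \<alpha>2 X \<longleftrightarrow>
     (\<forall>n. denominators_nonzero A1 (X n) \<and> X (Suc n) = step \<alpha>1 A1 \<alpha>2 (X n))"

definition orbit :: "real \<Rightarrow> real \<Rightarrow> real \<Rightarrow> real \<times> real \<Rightarrow> nat \<Rightarrow> real \<times> real" where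
  "orbit \<alpha>1 A1 \<alpha>2 z n = (step \<alpha>1 A1 \<alpha>2 ^^ n) z"

text \<open>Division by zero is total in HOL, so \<open>orbit\<close> is the orbit of the system only when no
  denominator vanishes along it; this is what admissibility demands.\<close>

definition admissible :: "real \<Rightarrow> real \<Rightarrow> real \<Rightarrow> real \<times> real \<Rightarrow> bool" where
  "admissible \<alpha>1 A1 \<alpha>2 z \<longleftrightarrow>
     fst z \<ge> 0 \<and> snd z \<ge> 0 \<and> (\<forall>n. denominators_nonzero A1 (orbit \<alpha>1 A1 \<alpha>2 z n))"

definition equilibrium :: "real \<Rightarrow> real \<Rightarrow> real \<Rightarrow> real \<times> real \<Rightarrow> bool" where
  "equilibrium \<alpha>1 A1 \<alpha>2 e \<longleftrightarrow> admissible \<alpha>1 A1 \<alpha>2 e \<and> is_solution \<alpha>1 A1 \<alpha>2 (\<lambda>n. e)"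

definition lyapunov_stable :: "real \<Rightarrow> real \<Rightarrow> real \<Rightarrow> real \<times> real \<Rightarrow> bool" where
  "lyapunov_stable \<alpha>1 A1 \<alpha>2 e \<longleftrightarrow>
     (\<forall>\<epsilon>>0. \<exists>\<delta>>0. \<forall>z. admissible \<alpha>1 A1 \<alpha>2 z \<and> dist z e < \<delta> \<longrightarrow>
        (\<forall>n. dist (orbit \<alpha>1 A1 \<alpha>2 z n) e < \<epsilon>))"

definition globally_asymptotically_stable ::
    "real \<Rightarrow> real \<Rightarrow> real \<Rightarrow> real \<times> real \<Rightarrow> bool" where
  "globally_asymptotically_stable \<alpha>1 A1 \<alpha>2 e \<longleftrightarrow>
     equilibrium \<alpha>1 A1 \<alpha>2 e \<and> lyapunov_stable \<alpha>1 A1 \<alpha>2 e \<and>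
     (\<forall>z. admissible \<alpha>1 A1 \<alpha>2 z \<longrightarrow> orbit \<alpha>1 A1 \<alpha>2 z \<longlonglongrightarrow> e)"

lemma is_solution_orbit:
  assumes "admissible \<alpha>1 A1 \<alpha>2 z"
  shows "is_solution \<alpha>1 A1 \<alpha>2 (orbit \<alpha>1 A1 \<alpha>2 z)"
  using assms by (simp add: is_solution_def admissible_def orbit_def)

lemma is_solution_eq_orbit:
  assumes "is_solution \<alpha>1 A1 \<alpha>2 X"
  shows "X = orbit \<alpha>1 A1 \<alpha>2 (X 0)"
proof
  fix n show "X n = orbit \<alpha>1 A1 \<alpha>2 (X 0) n"
    using assms by (induction n) (simp_all add: is_solution_def orbit_def)
qed

lemma admissible_iff:
  assumes "\<alpha>1 > 0" "A1 > 0" "\<alpha>2 > 0"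
  shows "admissible \<alpha>1 A1 \<alpha>2 z \<longleftrightarrow> fst z > 0 \<and> snd z \<ge> 0"
proof
  assume adm: "admissible \<alpha>1 A1 \<alpha>2 z"
  then have "denominators_nonzero A1 (orbit \<alpha>1 A1 \<alpha>2 z 0)"
    by (simp only: admissible_def)
  with adm show "fst z > 0 \<and> snd z \<ge> 0"
    by (simp add: admissible_def orbit_def denominators_nonzero_def)
next
  assume z: "fst z > 0 \<and> snd z \<ge> 0"
  have "fst (orbit \<alpha>1 A1 \<alpha>2 z n) > 0 \<and> snd (orbit \<alpha>1 A1 \<alpha>2 z n) \<ge> 0" for n
    using z assms by (induction n) (simp_all add: orbit_def step_def add_pos_nonneg)
  then have "denominators_nonzero A1 (orbit \<alpha>1 A1 \<alpha>2 z n)" for n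
    using assms(2) by (smt (verit) denominators_nonzero_def)
  with z show "admissible \<alpha>1 A1 \<alpha>2 z"
    by (simp add: admissible_def)
qed

end

theory Submission
  imports Defs "HOL-Real_Asymp.Real_Asymp"
begin

text \<open>In the coordinates \<open>u = 1/x\<close> and \<open>y\<close> the system is affine:
  \<open>u' = (A1 + y) / \<alpha>1\<close>, \<open>y' = \<alpha>2 u\<close>. If \<open>\<alpha>1 > \<alpha>2\<close>, it has the fixed point
  \<open>(c, \<alpha>2 c)\<close> with \<open>c = A1 / (\<alpha>1 - \<alpha>2)\<close>, and the weighted norm
  \<open>\<bar>y - \<alpha>2 c\<bar> + sqrt (\<alpha>1 \<alpha>2) \<bar>u - c\<bar>\<close> is multiplied by exactly \<open>sqrt (\<alpha>2 / \<alpha>1) < 1\<close> in each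
  step, which gives both stability and attraction. If \<open>\<alpha>1 \<le> \<alpha>2\<close>, two steps give
  \<open>y'' = (\<alpha>2 / \<alpha>1) (A1 + y) \<ge> A1 + y\<close>, so \<open>y\<close> tends to infinity and \<open>x' = \<alpha>1 / (A1 + y)\<close> to 0.\<close>

lemma orbit_0: "orbit \<alpha>1 A1 \<alpha>2 z 0 = z"
  by (simp add: orbit_def)

lemma orbit_Suc: "orbit \<alpha>1 A1 \<alpha>2 z (Suc n) = step \<alpha>1 A1 \<alpha>2 (orbit \<alpha>1 A1 \<alpha>2 z n)"
  by (simp add: orbit_def)

lemma orbit_pos:
  assumes "\<alpha>1 > 0" "A1 > 0" "\<alpha>2 > 0" "admissible \<alpha>1 A1 \<alpha>2 z"
  shows "fst (orbit \<alpha>1 A1 \<alpha>2 z n) > 0" "snd (orbit \<alpha>1 A1 \<alpha>2 z n) \<ge> 0"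
proof -
  have "fst (orbit \<alpha>1 A1 \<alpha>2 z n) > 0 \<and> snd (orbit \<alpha>1 A1 \<alpha>2 z n) \<ge> 0"
    using assms by (induction n) (auto simp: admissible_iff orbit_0 orbit_Suc step_def add_pos_nonneg)
  then show "fst (orbit \<alpha>1 A1 \<alpha>2 z n) > 0" "snd (orbit \<alpha>1 A1 \<alpha>2 z n) \<ge> 0"
    by auto
qed

text \<open>Clearing denominators in the fixed-point equations gives
  \<open>x * (A1 + y) = \<alpha>1\<close> and \<open>x * y = \<alpha>2\<close>. Subtracting leaves
  \<open>x * A1 = \<alpha>1 - \<alpha>2\<close>, which determines \<open>x\<close> and, as
  \<open>x\<close> and \<open>A1\<close> are positive, forces
  \<open>\<alpha>1 > \<alpha>2\<close>.\<close>

lemma equilibrium_iff: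
  assumes "\<alpha>1 > 0" "A1 > 0" "\<alpha>2 > 0"
  shows "equilibrium \<alpha>1 A1 \<alpha>2 z \<longleftrightarrow> \<alpha>1 > \<alpha>2 \<and> z = ((\<alpha>1 - \<alpha>2) / A1, \<alpha>2 * A1 / (\<alpha>1 - \<alpha>2))"
proof
  assume eq: "equilibrium \<alpha>1 A1 \<alpha>2 z"
  obtain x y where z: "z = (x, y)"
    by (cases z)
  have pos: "x > 0" "y \<ge> 0"
    using eq assms by (auto simp: equilibrium_def admissible_iff z)
  have fixed: "\<alpha>1 / (A1 + y) = x" "\<alpha>2 / x = y"
    using eq unfolding equilibrium_def is_solution_def step_def z prod.inject fst_conv snd_conv
    by metis+
  have "x * (A1 + y) = \<alpha>1"
    using fixed(1) pos assms by (simp only: divide_eq_eq split: if_splits)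
  moreover have "y * x = \<alpha>2"
    using fixed(2) pos by (simp only: divide_eq_eq split: if_splits)
  ultimately have xA: "x * A1 = \<alpha>1 - \<alpha>2"
    by (simp add: algebra_simps)
  with pos assms have gt: "\<alpha>1 > \<alpha>2"
    by (smt (verit) mult_pos_pos)
  have "x = (\<alpha>1 - \<alpha>2) / A1"
    using xA assms by (simp add: field_simps)
  moreover have "y = \<alpha>2 * A1 / (\<alpha>1 - \<alpha>2)"
    unfolding xA[symmetric] fixed(2)[symmetric] using pos assms by simp
  ultimately show "\<alpha>1 > \<alpha>2 \<and> z = ((\<alpha>1 - \<alpha>2) / A1, \<alpha>2 * A1 / (\<alpha>1 - \<alpha>2))"
    using gt z by simp
next
  assume R: "\<alpha>1 > \<alpha>2 \<and> z = ((\<alpha>1 - \<alpha>2) / A1, \<alpha>2 * A1 / (\<alpha>1 - \<alpha>2))"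
  then have adm: "admissible \<alpha>1 A1 \<alpha>2 z"
    using assms by (simp add: admissible_iff)
  have "A1 + \<alpha>2 * A1 / (\<alpha>1 - \<alpha>2) = \<alpha>1 * A1 / (\<alpha>1 - \<alpha>2)"
    using R by (simp add: field_simps)
  then have "step \<alpha>1 A1 \<alpha>2 z = z"
    using R assms by (simp add: step_def)
  then show "equilibrium \<alpha>1 A1 \<alpha>2 z"
    \<comment> \<open>The orbit at index 0 is \<open>z\<close> itself, so the solution property of
      the orbit supplies the nonvanishing denominators for the constant sequence.\<close>
    using adm is_solution_orbit[OF adm]
    by (simp add: equilibrium_def is_solution_def) (metis orbit_0)
qed

text \<open>A step exchanges the two terms: with weight \<open>w\<close> on the second one, it
  scales them by \<open>w / \<alpha>1\<close> and \<open>\<alpha>2 / w\<close>. These factors agree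
  exactly for \<open>w = sqrt (\<alpha>1 * \<alpha>2)\<close>.\<close>

definition deviation :: "real \<Rightarrow> real \<Rightarrow> real \<Rightarrow> real \<times> real \<Rightarrow> real" where
  "deviation \<alpha>1 A1 \<alpha>2 z =
     \<bar>snd z - \<alpha>2 * A1 / (\<alpha>1 - \<alpha>2)\<bar> + sqrt (\<alpha>1 * \<alpha>2) * \<bar>1 / fst z - A1 / (\<alpha>1 - \<alpha>2)\<bar>"

lemma deviation_step:
  assumes "\<alpha>2 > 0" "\<alpha>1 > \<alpha>2"
  shows "deviation \<alpha>1 A1 \<alpha>2 (step \<alpha>1 A1 \<alpha>2 z) = sqrt (\<alpha>2 / \<alpha>1) * deviation \<alpha>1 A1 \<alpha>2 z"
proof -
  define c where "c = A1 / (\<alpha>1 - \<alpha>2)"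
  have c: "\<alpha>2 * A1 / (\<alpha>1 - \<alpha>2) = \<alpha>2 * c" "A1 = (\<alpha>1 - \<alpha>2) * c"
    using assms by (simp_all add: c_def)
  have a: "\<alpha>1 > 0"
    using assms by simp
  have s1: "sqrt (\<alpha>2 / \<alpha>1) * sqrt (\<alpha>1 * \<alpha>2) = \<alpha>2"
    using assms a by (simp flip: real_sqrt_mult)
  have s2: "sqrt (\<alpha>1 * \<alpha>2) / \<alpha>1 = sqrt (\<alpha>2 / \<alpha>1)"
    using a by (simp add: real_sqrt_mult real_sqrt_divide field_simps)
  \<comment> \<open>This identity and the next hold for every \<open>z\<close>: a vanishing
    denominator makes the quotients 0 on both sides consistently, because
    \<open>1 / 0 = 0\<close>.\<close>
  have y: "\<alpha>2 / fst z - \<alpha>2 * c = \<alpha>2 * (1 / fst z - c)"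
    by (simp add: algebra_simps)
  have u: "1 / (\<alpha>1 / (A1 + snd z)) - c = (snd z - \<alpha>2 * c) / \<alpha>1"
    using a by (simp add: c(2) field_simps)
  have "deviation \<alpha>1 A1 \<alpha>2 (step \<alpha>1 A1 \<alpha>2 z)
      = \<bar>\<alpha>2 / fst z - \<alpha>2 * c\<bar> + sqrt (\<alpha>1 * \<alpha>2) * \<bar>1 / (\<alpha>1 / (A1 + snd z)) - c\<bar>"
    by (simp only: deviation_def step_def c(1) fst_conv snd_conv flip: c_def)
  also have "\<dots> = \<alpha>2 * \<bar>1 / fst z - c\<bar> + (sqrt (\<alpha>1 * \<alpha>2) / \<alpha>1) * \<bar>snd z - \<alpha>2 * c\<bar>"
    unfolding y u using a assms by (simp add: abs_mult)
  also have "\<dots> = sqrt (\<alpha>2 / \<alpha>1) * (\<bar>snd z - \<alpha>2 * c\<bar> + sqrt (\<alpha>1 * \<alpha>2) * \<bar>1 / fst z - c\<bar>)"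
    unfolding s2 distrib_left mult.assoc[symmetric] s1 by simp
  finally show ?thesis
    by (simp only: deviation_def c(1) flip: c_def)
qed

lemma deviation_orbit:
  assumes "\<alpha>2 > 0" "\<alpha>1 > \<alpha>2"
  shows "deviation \<alpha>1 A1 \<alpha>2 (orbit \<alpha>1 A1 \<alpha>2 z n) = sqrt (\<alpha>2 / \<alpha>1) ^ n * deviation \<alpha>1 A1 \<alpha>2 z"
  using assms by (induction n) (simp_all add: orbit_0 orbit_Suc deviation_step)

lemma deviation_nonneg:
  assumes "\<alpha>2 > 0" "\<alpha>1 > \<alpha>2"
  shows "deviation \<alpha>1 A1 \<alpha>2 z \<ge> 0"
  using assms by (simp add: deviation_def)

text \<open>Used at the equilibrium, where the deviation is 0: initial points close to it have small
  deviation.\<close>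

lemma isCont_deviation:
  assumes "fst z \<noteq> 0"
  shows "isCont (deviation \<alpha>1 A1 \<alpha>2) z"
  unfolding deviation_def using assms by (intro continuous_intros) auto

text \<open>The converse comparison, from small deviation back to small distance. It holds because
  \<open>(u, y) \<mapsto> (1 / u, y)\<close> is continuous at the fixed point of the affine system,
  whose first coordinate is positive.\<close>

lemma dist_less_of_deviation_less:
  assumes "A1 > 0" "\<alpha>2 > 0" "\<alpha>1 > \<alpha>2" "\<epsilon> > 0"
  obtains \<eta> where "\<eta> > 0"
    "\<And>z. deviation \<alpha>1 A1 \<alpha>2 z < \<eta> \<Longrightarrow> dist z ((\<alpha>1 - \<alpha>2) / A1, \<alpha>2 * A1 / (\<alpha>1 - \<alpha>2)) < \<epsilon>"
proof -
  define c where "c = A1 / (\<alpha>1 - \<alpha>2)"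
  define y where "y = \<alpha>2 * A1 / (\<alpha>1 - \<alpha>2)"
  define s where "s = sqrt (\<alpha>1 * \<alpha>2)"
  define g :: "real \<times> real \<Rightarrow> real \<times> real" where "g = (\<lambda>p. (1 / fst p, snd p))"
  have c0: "c > 0" and s0: "s > 0"
    using assms by (auto simp: c_def s_def)
  have "isCont g (c, y)"
    unfolding g_def using c0 by (intro continuous_intros) auto
  then obtain d where d: "d > 0" "\<And>p. dist p (c, y) < d \<Longrightarrow> dist (g p) (g (c, y)) < \<epsilon>"
    unfolding continuous_at_eps_delta using assms(4) by blast
  have e: "g (c, y) = ((\<alpha>1 - \<alpha>2) / A1, \<alpha>2 * A1 / (\<alpha>1 - \<alpha>2))"
    by (simp add: g_def c_def y_def)
  show thesis
  proof
    \<comment> \<open>The first bound controls the error in \<open>y\<close>. The second, after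
      division by the weight \<open>s\<close>, controls the error in \<open>1 / x\<close>. Each
      error is then below \<open>d / 2\<close>.\<close>
    show "min (d / 2) (s * d / 2) > 0"
      using d s0 by simp
  next
    fix z assume "deviation \<alpha>1 A1 \<alpha>2 z < min (d / 2) (s * d / 2)"
    then have dev: "\<bar>snd z - y\<bar> + s * \<bar>1 / fst z - c\<bar> < min (d / 2) (s * d / 2)"
      by (simp add: deviation_def s_def y_def c_def)
    have "\<bar>snd z - y\<bar> < d / 2"
      using dev s0 by (smt (verit) mult_nonneg_nonneg)
    moreover have "s * \<bar>1 / fst z - c\<bar> < s * (d / 2)"
      using dev by linarith
    then have "\<bar>1 / fst z - c\<bar> < d / 2"
      using s0 by (simp only: mult_less_cancel_left_pos)
    moreover have "dist (1 / fst z, snd z) (c, y) \<le> \<bar>1 / fst z - c\<bar> + \<bar>snd z - y\<bar>"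
      by (simp add: dist_Pair_Pair dist_real_def sqrt_sum_squares_le_sum_abs)
    ultimately have "dist (1 / fst z, snd z) (c, y) < d"
      by simp
    \<comment> \<open>Applying \<open>g\<close> undoes the inversion of the first coordinate, also
      when that coordinate is 0.\<close>
    from d(2)[OF this] show "dist z ((\<alpha>1 - \<alpha>2) / A1, \<alpha>2 * A1 / (\<alpha>1 - \<alpha>2)) < \<epsilon>"
      unfolding e by (simp add: g_def)
  qed
qed

lemma globally_asymptotically_stable_equilibrium:
  assumes "A1 > 0" "\<alpha>2 > 0" "\<alpha>1 > \<alpha>2"
  shows "globally_asymptotically_stable \<alpha>1 A1 \<alpha>2 ((\<alpha>1 - \<alpha>2) / A1, \<alpha>2 * A1 / (\<alpha>1 - \<alpha>2))"
    (is "globally_asymptotically_stable _ _ _ ?e")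
proof -
  let ?\<rho> = "sqrt (\<alpha>2 / \<alpha>1)"
  have \<rho>: "0 \<le> ?\<rho>" "?\<rho> < 1"
    using assms by auto
  have "equilibrium \<alpha>1 A1 \<alpha>2 ?e"
    using assms by (simp add: equilibrium_iff)
  moreover have "lyapunov_stable \<alpha>1 A1 \<alpha>2 ?e"
    unfolding lyapunov_stable_def
  proof (intro allI impI)
    fix \<epsilon> :: real assume "\<epsilon> > 0"
    then obtain \<eta> where \<eta>: "\<eta> > 0" "\<And>z. deviation \<alpha>1 A1 \<alpha>2 z < \<eta> \<Longrightarrow> dist z ?e < \<epsilon>"
      using dist_less_of_deviation_less assms by metis
    have "isCont (deviation \<alpha>1 A1 \<alpha>2) ?e"
      using assms by (intro isCont_deviation) simp
    moreover have "deviation \<alpha>1 A1 \<alpha>2 ?e = 0"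
      by (simp add: deviation_def)
    ultimately obtain d where d: "d > 0"
        "\<And>z. dist z ?e < d \<Longrightarrow> dist (deviation \<alpha>1 A1 \<alpha>2 z) 0 < \<eta>"
      unfolding continuous_at_eps_delta using \<eta>(1) by metis
    have "dist (orbit \<alpha>1 A1 \<alpha>2 z n) ?e < \<epsilon>" if "dist z ?e < d" for z n
    proof (rule \<eta>(2))
      \<comment> \<open>The deviation never grows along an orbit, so the radius \<open>d\<close>
        chosen for the initial point serves all \<open>n\<close> at once.\<close>
      have "?\<rho> ^ n * deviation \<alpha>1 A1 \<alpha>2 z \<le> 1 * deviation \<alpha>1 A1 \<alpha>2 z"
        using \<rho> assms by (intro mult_right_mono power_le_one deviation_nonneg) auto
      then show "deviation \<alpha>1 A1 \<alpha>2 (orbit \<alpha>1 A1 \<alpha>2 z n) < \<eta>"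
        using d(2)[OF that] assms by (simp add: deviation_orbit)
    qed
    with d(1) show "\<exists>\<delta>>0. \<forall>z. admissible \<alpha>1 A1 \<alpha>2 z \<and> dist z ?e < \<delta> \<longrightarrow>
        (\<forall>n. dist (orbit \<alpha>1 A1 \<alpha>2 z n) ?e < \<epsilon>)"
      by blast
  qed
  moreover have "orbit \<alpha>1 A1 \<alpha>2 z \<longlonglongrightarrow> ?e" for z
  proof (rule tendstoI)
    fix \<epsilon> :: real assume "\<epsilon> > 0"
    then obtain \<eta> where \<eta>: "\<eta> > 0" "\<And>z. deviation \<alpha>1 A1 \<alpha>2 z < \<eta> \<Longrightarrow> dist z ?e < \<epsilon>"
      using dist_less_of_deviation_less assms by metis
    have "(\<lambda>n. ?\<rho> ^ n * deviation \<alpha>1 A1 \<alpha>2 z) \<longlonglongrightarrow> 0"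
      using \<rho> by (intro tendsto_mult_left_zero LIMSEQ_realpow_zero)
    then have "\<forall>\<^sub>F n in sequentially. deviation \<alpha>1 A1 \<alpha>2 (orbit \<alpha>1 A1 \<alpha>2 z n) < \<eta>"
      using \<eta>(1) assms by (simp add: deviation_orbit order_tendstoD(2))
    then show "\<forall>\<^sub>F n in sequentially. dist (orbit \<alpha>1 A1 \<alpha>2 z n) ?e < \<epsilon>"
      by eventually_elim (rule \<eta>(2))
  qed
  ultimately show ?thesis
    by (simp add: globally_asymptotically_stable_def)
qed

text \<open>Every two steps add at least \<open>A1\<close>, so the induction advances by two. The
  linear bound is at most 0 for \<open>n = 0\<close> and \<open>n = 1\<close>, so both base cases
  reduce to nonnegativity of the orbit.\<close>

lemma snd_orbit_lower_bound:
  assumes "\<alpha>1 > 0" "A1 > 0" "\<alpha>1 \<le> \<alpha>2" "admissible \<alpha>1 A1 \<alpha>2 z"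
  shows "A1 * ((real n - 1) / 2) \<le> snd (orbit \<alpha>1 A1 \<alpha>2 z n)"
proof (induction n rule: induct_nat_012)
  case 0
  have "A1 * ((real 0 - 1) / 2) \<le> 0"
    using assms by simp
  also have "\<dots> \<le> snd (orbit \<alpha>1 A1 \<alpha>2 z 0)"
    using assms by (intro orbit_pos) auto
  finally show ?case .
next
  case 1
  have "A1 * ((real (Suc 0) - 1) / 2) = 0"
    by simp
  also have "\<dots> \<le> snd (orbit \<alpha>1 A1 \<alpha>2 z (Suc 0))"
    using assms by (intro orbit_pos) auto
  finally show ?case .
next
  case (ge2 n)
  let ?y = "snd (orbit \<alpha>1 A1 \<alpha>2 z n)"
  have y: "?y \<ge> 0"
    using orbit_pos assms by simp
  have "A1 * ((real (Suc (Suc n)) - 1) / 2) = A1 + A1 * ((real n - 1) / 2)"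
    by (simp add: field_simps)
  also have "\<dots> \<le> 1 * (A1 + ?y)"
    using ge2 by simp
  also have "\<dots> \<le> (\<alpha>2 / \<alpha>1) * (A1 + ?y)"
    using assms y by (intro mult_right_mono) auto
  also have "\<dots> = snd (orbit \<alpha>1 A1 \<alpha>2 z (Suc (Suc n)))"
    by (simp add: orbit_Suc step_def)
  finally show ?case .
qed

lemma orbit_diverges:
  assumes "\<alpha>1 > 0" "A1 > 0" "\<alpha>1 \<le> \<alpha>2" "admissible \<alpha>1 A1 \<alpha>2 z"
  shows "filterlim (\<lambda>n. snd (orbit \<alpha>1 A1 \<alpha>2 z n)) at_top sequentially"
    and "(\<lambda>n. fst (orbit \<alpha>1 A1 \<alpha>2 z n)) \<longlonglongrightarrow> 0"
proof -
  have "filterlim (\<lambda>n. A1 * ((real n - 1) / 2)) at_top sequentially"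
    using assms(2) by real_asymp
  then show y: "filterlim (\<lambda>n. snd (orbit \<alpha>1 A1 \<alpha>2 z n)) at_top sequentially"
    by (rule filterlim_at_top_mono) (intro always_eventually allI snd_orbit_lower_bound assms)
  have "filterlim (\<lambda>n. A1 + snd (orbit \<alpha>1 A1 \<alpha>2 z n)) at_top sequentially"
    by (rule filterlim_tendsto_add_at_top[OF tendsto_const y])
  then have "(\<lambda>n. \<alpha>1 / (A1 + snd (orbit \<alpha>1 A1 \<alpha>2 z n))) \<longlonglongrightarrow> 0"
    by (intro tendsto_divide_0[OF tendsto_const] filterlim_at_top_imp_at_infinity)
  \<comment> \<open>The quotient in the previous limit is the first coordinate one step later, so
    the limit is obtained for the shifted sequence first.\<close>
  then have "(\<lambda>n. fst (orbit \<alpha>1 A1 \<alpha>2 z (Suc n))) \<longlonglongrightarrow> 0"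
    by (simp add: orbit_Suc step_def)
  then show "(\<lambda>n. fst (orbit \<alpha>1 A1 \<alpha>2 z n)) \<longlonglongrightarrow> 0"
    by (rule LIMSEQ_imp_Suc)
qed

theorem theorem3:
  fixes \<alpha>1 A1 \<alpha>2 :: real
  assumes "\<alpha>1 > 0" and "A1 > 0" and "\<alpha>2 > 0"
  shows "(\<alpha>1 > \<alpha>2 \<longrightarrow>
           (let e = (\<alpha>1 * (\<alpha>1 - \<alpha>2) / (A1 * (\<alpha>1 - \<alpha>2) + \<alpha>2 * A1), \<alpha>2 * A1 / (\<alpha>1 - \<alpha>2))
            in (\<forall>z. equilibrium \<alpha>1 A1 \<alpha>2 z \<longleftrightarrow> z = e) \<and>
               globally_asymptotically_stable \<alpha>1 A1 \<alpha>2 e)) \<and>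
         (\<alpha>1 \<le> \<alpha>2 \<longrightarrow>
           (\<nexists>z. equilibrium \<alpha>1 A1 \<alpha>2 z) \<and>
           (\<forall>z. admissible \<alpha>1 A1 \<alpha>2 z \<longrightarrow>
              (\<lambda>n. fst (orbit \<alpha>1 A1 \<alpha>2 z n)) \<longlonglongrightarrow> 0 \<and>
              filterlim (\<lambda>n. snd (orbit \<alpha>1 A1 \<alpha>2 z n)) at_top sequentially))"
proof -
  \<comment> \<open>The denominator collapses to \<open>\<alpha>1 * A1\<close>; cancelling
    \<open>\<alpha>1\<close> brings the stated equilibrium to the form used in the lemmas.\<close>
  have "A1 * (\<alpha>1 - \<alpha>2) + \<alpha>2 * A1 = \<alpha>1 * A1"
    by (simp add: algebra_simps)
  then have e: "\<alpha>1 * (\<alpha>1 - \<alpha>2) / (A1 * (\<alpha>1 - \<alpha>2) + \<alpha>2 * A1) = (\<alpha>1 - \<alpha>2) / A1"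
    using assms by simp
  show ?thesis
    unfolding e Let_def using assms
    by (auto simp: equilibrium_iff globally_asymptotically_stable_equilibrium orbit_diverges)
qed

end
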